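(* Let $p$ be three times differentiable on $\mathbb{R}$ with $p'''$ a function of bounded variation, $\mathbf{V}(p''')=V_3<\infty$, and let $p$ be bounded by $a$. If $h_n=h_0n^{-1/5}$ for some constant $h_0>0$, then the kernel estimator $p_n=p_{n,h_n}$ satisfies $$\sup_{x\in\mathbb{R}}\mathrm{MSE}(p_n(x))\le\Bigl\{\frac{4}{9\pi^2}\mu_2^2(K)V_3^{3/2}h_0^4+\frac{2aA(K)}{h_0}\Bigr\}n^{-4/5}.$$
   Context: Let $X_1,\dots,X_n$ be i.i.d. real random variables with probability density $p$. The kernel $K$ is a square integrable probability density on $\mathbb{R}$ with characteristic function $\varphi(t)=\int e^{itx}K(x)\,dx$. For a bandwidth $h>0$ set $K_h(x)=h^{-1}K(h^{-1}x)$ and $p_{n,h}(x)=\frac1n\sum_{j=1}^nK_h(x-X_j)$. Define $\mathrm{MSE}(p_{n,h}(x))=\mathrm{E}\{p_{n,h}(x)-p(x)\}^2$. Notation (provided the integrals exist): $\mu_2(K)=\int x^2K(x)\,dx$, $\mu_2^2(K)=(\mu_2(K))^2$, $A(K)=\frac1{2\pi}\int|\varphi(t)|\,dt$; $\mathbf{V}(g)$ is the total variation of $g$ over the whole real line.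
   Formalization: The kernel K is additionally assumed to have mean zero (∫ x K(x) dx = 0); without this the bias is of order h_n and the stated bound fails for large n, e.g. for K the N(1,1) density and p the N(0,1) density. *)

theory Defs
  imports "HOL-Probability.Probability"
begin

definition prob_density :: "(real \<Rightarrow> real) \<Rightarrow> bool" where
  "prob_density f \<longleftrightarrow>
     f \<in> borel_measurable borel \<and> (\<forall>x. 0 \<le> f x) \<and> (\<integral>\<^sup>+x. ennreal (f x) \<partial>lborel) = 1"

(* Supremum over all finite partitions t_0 <= t_1 <= ... of points of the real line,
   with value top if the variation is unbounded. *)
definition total_variation :: "(real \<Rightarrow> real) \<Rightarrow> ennreal" where
  "total_variation g =
     (SUP ts\<in>{ts. sorted ts}. \<Sum>i<length ts - 1. ennreal \<bar>g (ts ! Suc i) - g (ts ! i)\<bar>)"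

definition char_density :: "(real \<Rightarrow> real) \<Rightarrow> real \<Rightarrow> complex" where
  "char_density K = char (density lborel (\<lambda>x. ennreal (K x)))"

definition mu2 :: "(real \<Rightarrow> real) \<Rightarrow> real" where
  "mu2 K = (LINT x|lborel. x\<^sup>2 * K x)"

definition A_const :: "(real \<Rightarrow> real) \<Rightarrow> real" where
  "A_const K = 1 / (2 * pi) * (LINT t|lborel. cmod (char_density K t))"

definition scaled_kernel :: "(real \<Rightarrow> real) \<Rightarrow> real \<Rightarrow> real \<Rightarrow> real" where
  "scaled_kernel K h x = K (x / h) / h"

definition kernel_estimator ::
  "(real \<Rightarrow> real) \<Rightarrow> real \<Rightarrow> nat \<Rightarrow> (nat \<Rightarrow> 'a \<Rightarrow> real) \<Rightarrow> real \<Rightarrow> 'a \<Rightarrow> real" where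
  "kernel_estimator K h n X x \<omega> = 1 / real n * (\<Sum>j=1..n. scaled_kernel K h (x - X j \<omega>))"

(* The expectation is taken in ennreal, so that a non-integrable squared error has MSE top
   and not the default value 0 of the Bochner integral. *)
definition MSE :: "'a measure \<Rightarrow> ('a \<Rightarrow> real) \<Rightarrow> real \<Rightarrow> ennreal" where
  "MSE M T \<theta> = (\<integral>\<^sup>+\<omega>. ennreal ((T \<omega> - \<theta>)\<^sup>2) \<partial>M)"

end

theory Submission
  imports Defs "HOL-Real_Asymp.Real_Asymp"
begin

text \<open>The mean squared error is squared bias plus variance. By Taylor expansion the bias is at most
  \<open>h\<^sup>2 / 2 * mu2 K * sup \<bar>p''\<bar>\<close>, so the theorem needs the Landau-Kolmogorov type inequality
  \<open>\<bar>p''\<bar> \<le> 4 / (3 * pi) * V3 powr (3 / 4)\<close>. It is obtained without Fourier analysis: integrating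
  \<open>p'''\<close> by parts against an explicit piecewise polynomial supported in \<open>[x - L, x + L]\<close> bounds
  \<open>\<bar>p'' x\<bar>\<close> by \<open>6 / L ^ 3 + 3 / 40 * L * V3\<close>, and \<open>L = 4 * V3 powr (- 1 / 4)\<close> gives the constant
  \<open>63 / 160 < 4 / (3 * pi)\<close>. The variance is at most \<open>a / (n * h)\<close> times the integral of \<open>K\<^sup>2\<close>,
  which is at most \<open>A_const K\<close> because Levy's inversion formula gives \<open>K \<le> A_const K\<close> almost
  everywhere.\<close>

section \<open>Bounding the second derivative of a density by the variation of the third\<close>

text \<open>Each of three applications of the mean value theorem trades one order of the difference
  for one derivative. This locates points where \<open>f3\<close> is controlled by values of
  \<open>f\<close> alone.\<close>

lemma third_difference_mvt:
  fixes f f1 f2 f3 :: "real \<Rightarrow> real"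
  assumes "\<And>x. (f has_real_derivative f1 x) (at x)"
    and "\<And>x. (f1 has_real_derivative f2 x) (at x)"
    and "\<And>x. (f2 has_real_derivative f3 x) (at x)"
    and h: "h > 0"
  shows "\<exists>z. x < z \<and> z < x + 3 * h \<and>
    f (x + 3 * h) - 3 * f (x + 2 * h) + 3 * f (x + h) - f x = h ^ 3 * f3 z"
proof -
  note [derivative_intros] = assms(1-3)[THEN DERIV_chain2]
  obtain u where u: "x < u" "u < x + h"
    and fu: "(f (x + h + 2 * h) - 2 * f (x + h + h) + f (x + h)) - (f (x + 2 * h) - 2 * f (x + h) + f x)
      = (x + h - x) * (f1 (u + 2 * h) - 2 * f1 (u + h) + f1 u)"
    using MVT2[of x "x + h" "\<lambda>t. f (t + 2 * h) - 2 * f (t + h) + f t"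
        "\<lambda>t. f1 (t + 2 * h) - 2 * f1 (t + h) + f1 t"] h
    by (force intro!: derivative_eq_intros assms)
  obtain v where v: "u < v" "v < u + h"
    and fv: "(f1 (u + h + h) - f1 (u + h)) - (f1 (u + h) - f1 u) = (u + h - u) * (f2 (v + h) - f2 v)"
    using MVT2[of u "u + h" "\<lambda>t. f1 (t + h) - f1 t" "\<lambda>t. f2 (t + h) - f2 t"] h
    by (force intro!: derivative_eq_intros assms)
  obtain w where w: "v < w" "w < v + h" and fw: "f2 (v + h) - f2 v = (v + h - v) * f3 w"
    using MVT2[of v "v + h" f2 f3] h assms(3) by force
  have "f (x + 3 * h) - 3 * f (x + 2 * h) + 3 * f (x + h) - f x = h * (h * (h * f3 w))"
  proof -
    have "f1 (u + 2 * h) - 2 * f1 (u + h) + f1 u = h * (h * f3 w)"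
      using fv unfolding fw by (simp add: algebra_simps)
    with fu have "(f (x + h + 2 * h) - 2 * f (x + h + h) + f (x + h)) - (f (x + 2 * h) - 2 * f (x + h) + f x)
        = h * (h * (h * f3 w))"
      by simp
    then show ?thesis by (simp add: algebra_simps)
  qed
  then show ?thesis
    using u v w by (intro exI[of _ w]) (auto simp: power3_eq_cube)
qed

text \<open>The third difference of a function bounded by \<open>B\<close> is at most
  \<open>8 * B\<close> (coefficients 1, 3, 3, 1), so a large step forces \<open>f3\<close> to be
  small somewhere in between. The window length \<open>d\<close> is uniform in
  \<open>x\<close>.\<close>

lemma third_derivative_small:
  fixes f f1 f2 f3 :: "real \<Rightarrow> real"
  assumes "\<And>x. (f has_real_derivative f1 x) (at x)"
    and "\<And>x. (f1 has_real_derivative f2 x) (at x)"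
    and "\<And>x. (f2 has_real_derivative f3 x) (at x)"
    and bound: "\<And>x. \<bar>f x\<bar> \<le> B" and e: "e > 0"
  shows "\<exists>d>0. \<forall>x. \<exists>z. x < z \<and> z < x + d \<and> \<bar>f3 z\<bar> \<le> e"
proof -
  \<comment> \<open>The lower bound 1 gives \<open>h <= h ^ 3\<close>, so the linear estimate
    \<open>8 * B <= e * h\<close> suffices and no cube root appears.\<close>
  define h where "h = max 1 (8 * B / e)"
  have h: "h \<ge> 1" "8 * B / e \<le> h" by (auto simp: h_def)
  have "8 * B \<le> e * h" using h(2) e by (simp add: field_simps)
  also have "\<dots> \<le> e * h ^ 3"
    using h(1) e power_increasing[of 1 3 h] by auto
  finally have eh: "8 * B \<le> e * h ^ 3" .
  have "\<exists>z. x < z \<and> z < x + 3 * h \<and> \<bar>f3 z\<bar> \<le> e" for x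
  proof -
    obtain z where z: "x < z" "z < x + 3 * h"
      "f (x + 3 * h) - 3 * f (x + 2 * h) + 3 * f (x + h) - f x = h ^ 3 * f3 z"
      using third_difference_mvt[OF assms(1-3), of h x] h by auto
    have "h ^ 3 * \<bar>f3 z\<bar> = \<bar>h ^ 3 * f3 z\<bar>"
      using h by (simp add: abs_mult)
    also have "\<dots> \<le> 8 * B"
      using bound[of "x + 3 * h"] bound[of "x + 2 * h"] bound[of "x + h"] bound[of x]
      unfolding z(3)[symmetric] by linarith
    also note eh
    finally have "h ^ 3 * \<bar>f3 z\<bar> \<le> h ^ 3 * e" by (simp add: mult.commute)
    then have "\<bar>f3 z\<bar> \<le> e" using h by simp
    with z show ?thesis by auto
  qed
  with h show ?thesis by (intro exI[of _ "3 * h"]) auto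
qed

lemma total_variation_four_points:
  assumes "total_variation g = ennreal V" "0 \<le> V" "a \<le> b" "b \<le> c" "c \<le> d"
  shows "\<bar>g b - g a\<bar> + \<bar>g c - g b\<bar> + \<bar>g d - g c\<bar> \<le> V"
proof -
  have "(\<Sum>i<length [a, b, c, d] - 1. ennreal \<bar>g ([a, b, c, d] ! Suc i) - g ([a, b, c, d] ! i)\<bar>)
      \<le> total_variation g"
    unfolding total_variation_def using assms by (intro SUP_upper) auto
  then have "ennreal (\<bar>g b - g a\<bar> + \<bar>g c - g b\<bar> + \<bar>g d - g c\<bar>) \<le> ennreal V"
    by (simp add: assms(1) numeral_eq_Suc lessThan_Suc ennreal_plus[symmetric] add_ac del: ennreal_plus)
  then show ?thesis using ennreal_le_iff[OF assms(2)] by blast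
qed

text \<open>The third derivative of a bounded function comes arbitrarily close to 0 near both ends of the
  line, so its variation counts every oscillation twice.\<close>

lemma third_derivative_oscillation:
  fixes f f1 f2 f3 :: "real \<Rightarrow> real"
  assumes deriv: "\<And>x. (f has_real_derivative f1 x) (at x)"
    "\<And>x. (f1 has_real_derivative f2 x) (at x)"
    "\<And>x. (f2 has_real_derivative f3 x) (at x)"
    and bound: "\<And>x. \<bar>f x\<bar> \<le> B"
    and tv: "total_variation f3 = ennreal V" "0 \<le> V"
  shows "\<bar>f3 x - f3 y\<bar> \<le> V / 2"
proof -
  have *: "\<bar>f3 y - f3 x\<bar> \<le> V / 2" if "x \<le> y" for x y
  proof (rule field_le_epsilon)
    fix e :: real assume "e > 0"
    then obtain d where d: "d > 0" "\<And>x. \<exists>z. x < z \<and> z < x + d \<and> \<bar>f3 z\<bar> \<le> e"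
      using third_derivative_small[OF deriv bound] by meson
    obtain u where u: "u < x" "\<bar>f3 u\<bar> \<le> e" using d(2)[of "x - d"] by auto
    obtain v where v: "y < v" "\<bar>f3 v\<bar> \<le> e" using d(2)[of y] by auto
    have "\<bar>f3 x - f3 u\<bar> + \<bar>f3 y - f3 x\<bar> + \<bar>f3 v - f3 y\<bar> \<le> V"
      using total_variation_four_points[OF tv, of u x y v] u v that by auto
    \<comment> \<open>Since \<open>f3 u\<close> and \<open>f3 v\<close> are within \<open>e\<close>
      of 0, the two outer increments sum to at least the middle one minus
      \<open>2 * e\<close>.\<close>
    then show "\<bar>f3 y - f3 x\<bar> \<le> V / 2 + e" using u v by linarith
  qed
  show ?thesis using *[of x y] *[of y x] by linarith
qed

text \<open>Symmetrising about \<open>x\<close> and moving derivatives onto the weight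
  \<open>D1 (t / L)\<close> leaves two pairings: \<open>D1\<close> with a difference of values of
  \<open>f3\<close>, at most \<open>W\<close>, and its third derivative \<open>D4\<close>, at most 6
  in modulus, with the mass of \<open>f\<close>. The scale \<open>L\<close> stays free so that the
  two terms can be balanced.\<close>

lemma second_derivative_bound_scale:
  fixes f f1 f2 f3 :: "real \<Rightarrow> real"
  assumes deriv: "\<And>x. (f has_real_derivative f1 x) (at x)"
    "\<And>x. (f1 has_real_derivative f2 x) (at x)"
    "\<And>x. (f2 has_real_derivative f3 x) (at x)"
    and nonneg: "\<And>x. 0 \<le> f x" and int: "integrable lborel f"
    and osc: "\<And>x y. \<bar>f3 x - f3 y\<bar> \<le> W" and L: "L > 0"
  shows "\<bar>f2 x\<bar> \<le> 6 / L ^ 3 * (LINT x|lborel. f x) + 3 / 20 * L * W"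
proof -
  note [derivative_intros] = deriv[THEN DERIV_chain2]
  have cont: "continuous_on S f" for S
    using deriv(1) DERIV_isCont by (blast intro: continuous_at_imp_continuous_on)
  \<comment> \<open>The margin of 1 makes \<open>x - L\<close> and \<open>x + L\<close> interior
    points, where \<open>F\<close> has a two-sided derivative.\<close>
  define F where "F y = integral {x - L - 1..y} f" for y
  have DF: "(F has_real_derivative f y) (at y)" if "x - L - 1 < y" "y < x + L + 1" for y
  proof -
    have "(F has_real_derivative f y) (at y within {x - L - 1..x + L + 1})"
      unfolding F_def using that cont by (intro integral_has_real_derivative) auto
    then show ?thesis
      using that by (simp add: at_within_Icc_at)
  qed
  \<comment> \<open>\<open>D1\<close> is normalised by \<open>D1 0 = 1 / 2\<close> and \<open>D3 0 = 0\<close>, so that \<open>\<Phi> 0\<close> below is \<open>f2 x\<close>, and vanishes to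
    third order at 1, so that \<open>\<Phi> L = 0\<close>. The claim follows by comparing \<open>\<Phi>\<close> with \<open>\<Psi>\<close>; no integral
    of \<open>f3\<close> is needed.\<close>
  define D1 where "D1 s = (1 - s) ^ 3 * (1 + s) / 2" for s :: real
  define D2 where "D2 s = - ((1 - s)\<^sup>2 * (1 + 2 * s))" for s :: real
  define D3 where "D3 s = 6 * s * (1 - s)" for s :: real
  define D4 where "D4 s = 6 - 12 * s" for s :: real
  \<comment> \<open>The antiderivative of \<open>D1\<close> that vanishes at 1;
    \<open>G 0 = - 3 / 20\<close> is the source of the constant 3/20.\<close>
  define G where "G s = - ((1 - s) ^ 4 * (3 + 2 * s) / 20)" for s :: real
  have G: "(G has_real_derivative D1 s) (at s)" for s
    unfolding G_def[abs_def] D1_def by (rule derivative_eq_intros refl | simp)+ (simp add: field_simps, algebra)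
  have D1: "(D1 has_real_derivative D2 s) (at s)" for s
    unfolding D1_def[abs_def] D2_def by (rule derivative_eq_intros refl | simp)+ (simp add: field_simps, algebra)
  have D2: "(D2 has_real_derivative D3 s) (at s)" for s
    unfolding D2_def[abs_def] D3_def by (rule derivative_eq_intros refl | simp)+ (simp add: field_simps, algebra)
  have D3: "(D3 has_real_derivative D4 s) (at s)" for s
    unfolding D3_def[abs_def] D4_def by (rule derivative_eq_intros refl | simp)+
  note [derivative_intros] = G[THEN DERIV_chain2] D1[THEN DERIV_chain2] D2[THEN DERIV_chain2] D3[THEN DERIV_chain2]
  define \<Phi> where "\<Phi> t = D1 (t / L) * (f2 (x + t) + f2 (x - t)) - D2 (t / L) / L * (f1 (x + t) - f1 (x - t))
    + D3 (t / L) / L\<^sup>2 * (f (x + t) + f (x - t))" for t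
  define \<phi> where "\<phi> t = D1 (t / L) * (f3 (x + t) - f3 (x - t)) + D4 (t / L) / L ^ 3 * (f (x + t) + f (x - t))" for t
  define \<Psi> where "\<Psi> t = L * W * G (t / L) + 6 / L ^ 3 * (F (x + t) - F (x - t))" for t
  define \<psi> where "\<psi> t = W * D1 (t / L) + 6 / L ^ 3 * (f (x + t) + f (x - t))" for t
  have D\<Phi>: "(\<Phi> has_real_derivative \<phi> t) (at t)" for t
    unfolding \<Phi>_def[abs_def] \<phi>_def using L
    by (auto intro!: derivative_eq_intros simp: field_simps power2_eq_square power3_eq_cube)
  note [derivative_intros] = DF[THEN DERIV_chain2]
  have D\<Psi>: "(\<Psi> has_real_derivative \<psi> t) (at t)" if "0 \<le> t" "t \<le> L" for t
    unfolding \<Psi>_def[abs_def] \<psi>_def using L that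
    by (auto intro!: derivative_eq_intros simp: field_simps)
  have le: "\<bar>\<phi> t\<bar> \<le> \<psi> t" if t: "0 \<le> t" "t \<le> L" for t
  proof -
    define s where "s = t / L"
    have s: "0 \<le> s" "s \<le> 1" using t L by (auto simp: s_def)
    have "0 \<le> D1 s" using s by (simp add: D1_def)
    then have 1: "\<bar>D1 s * (f3 (x + t) - f3 (x - t))\<bar> \<le> D1 s * W"
      using osc by (simp add: abs_mult mult_left_mono)
    have "\<bar>D4 s\<bar> \<le> 6" using s by (simp add: D4_def abs_le_iff)
    then have 2: "\<bar>D4 s / L ^ 3 * (f (x + t) + f (x - t))\<bar> \<le> 6 / L ^ 3 * (f (x + t) + f (x - t))"
      unfolding abs_mult using L nonneg by (intro mult_mono) (auto simp: divide_right_mono)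
    show ?thesis using 1 2 unfolding \<phi>_def \<psi>_def s_def[symmetric] mult.commute[of W] by linarith
  qed
  have "\<Psi> 0 - \<Phi> 0 \<le> \<Psi> L - \<Phi> L"
  proof (rule DERIV_nonneg_imp_nondecreasing[of 0 L "\<lambda>t. \<Psi> t - \<Phi> t"])
    show "\<exists>y. ((\<lambda>t. \<Psi> t - \<Phi> t) has_real_derivative y) (at t) \<and> 0 \<le> y" if "0 \<le> t" "t \<le> L" for t
      using DERIV_diff[OF D\<Psi>[OF that] D\<Phi>[of t]] le[OF that] by (intro exI[of _ "\<psi> t - \<phi> t"]) auto
  qed (use L in auto)
  moreover have "\<Psi> 0 + \<Phi> 0 \<le> \<Psi> L + \<Phi> L"
  proof (rule DERIV_nonneg_imp_nondecreasing[of 0 L "\<lambda>t. \<Psi> t + \<Phi> t"])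
    show "\<exists>y. ((\<lambda>t. \<Psi> t + \<Phi> t) has_real_derivative y) (at t) \<and> 0 \<le> y" if "0 \<le> t" "t \<le> L" for t
      using DERIV_add[OF D\<Psi>[OF that] D\<Phi>[of t]] le[OF that] by (intro exI[of _ "\<psi> t + \<phi> t"]) auto
  qed (use L in auto)
  moreover have "\<Phi> L = 0" "\<Phi> 0 = f2 x"
    using L by (auto simp: \<Phi>_def D1_def D2_def D3_def)
  moreover have "F (x + L) - F (x - L) \<le> (LINT x|lborel. f x)"
  proof -
    have "0 \<le> F (x - L)"
      unfolding F_def using nonneg cont by (intro integral_nonneg integrable_continuous_interval) auto
    moreover have "F (x + L) \<le> integral UNIV f"
      unfolding F_def using nonneg cont has_integral_integral_lborel[OF int]
      by (intro integral_subset_le integrable_continuous_interval) (auto simp: has_integral_iff)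
    ultimately show ?thesis
      using integral_unique[OF has_integral_integral_lborel[OF int]] by simp
  qed
  then have "6 / L ^ 3 * (F (x + L) - F (x - L)) \<le> 6 / L ^ 3 * (LINT x|lborel. f x)"
    using L by (intro mult_left_mono) auto
  then have "\<Psi> L - \<Psi> 0 \<le> 6 / L ^ 3 * (LINT x|lborel. f x) + 3 / 20 * L * W"
    using L by (simp add: \<Psi>_def G_def)
  ultimately show ?thesis by linarith
qed

text \<open>The terms of order \<open>1 / L ^ 3\<close> and \<open>L * V\<close> balance when
  \<open>L\<close> is of order \<open>V powr (- 1 / 4)\<close>, whence the exponent 3/4. The
  coefficient 3/40 is 3/20 combined with the oscillation bound \<open>V / 2\<close>.\<close>

lemma second_derivative_bound:
  fixes f f1 f2 f3 :: "real \<Rightarrow> real"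
  assumes deriv: "\<And>x. (f has_real_derivative f1 x) (at x)"
    "\<And>x. (f1 has_real_derivative f2 x) (at x)"
    "\<And>x. (f2 has_real_derivative f3 x) (at x)"
    and dens: "prob_density f" and bound: "\<And>x. f x \<le> B"
    and tv: "total_variation f3 = ennreal V" "0 \<le> V"
  shows "\<bar>f2 x\<bar> \<le> 4 / (3 * pi) * V powr (3 / 4)"
proof -
  have nonneg: "\<And>x. 0 \<le> f x" and [measurable]: "f \<in> borel_measurable borel"
    and nn1: "(\<integral>\<^sup>+x. ennreal (f x) \<partial>lborel) = 1"
    using dens by (auto simp: prob_density_def)
  have int: "integrable lborel f" and int1: "(LINT x|lborel. f x) = 1"
    using nonneg nn1 by (auto simp: integrable_iff_bounded integral_eq_nn_integral)
  have osc: "\<bar>f3 x - f3 y\<bar> \<le> V / 2" for x y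
    by (rule third_derivative_oscillation[OF deriv _ tv, of B]) (use nonneg bound in auto)
  have le: "\<bar>f2 x\<bar> \<le> 6 / L ^ 3 + 3 / 40 * L * V" if "L > 0" for L
    using second_derivative_bound_scale[OF deriv nonneg int osc that, of x] int1 by simp
  show ?thesis
  proof (cases "V = 0")
    case True
    \<comment> \<open>For \<open>V = 0\<close> no finite scale is optimal; letting \<open>L\<close>
      tend to infinity removes the only remaining term.\<close>
    have "((\<lambda>L::real. 6 / L ^ 3) \<longlongrightarrow> 0) at_top" by real_asymp
    then have "\<bar>f2 x\<bar> \<le> 0"
      using le True by (intro tendsto_lowerbound[where F = at_top])
        (auto intro: eventually_mono[OF eventually_gt_at_top[of 0]])
    then show ?thesis using True by simp
  next
    case False
    define v where "v = V powr (1 / 4)"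
    have v: "v > 0" "V = v ^ 4" "V powr (3 / 4) = v ^ 3"
      using False tv(2) by (auto simp: v_def powr_realpow[symmetric] powr_powr)
    \<comment> \<open>The bound is minimal at \<open>240 powr (1 / 4) / v\<close>, about
      \<open>3.94 / v\<close>; rounding to \<open>4 / v\<close> gives
      \<open>6 / 64 + 3 / 10 = 63 / 160\<close>.\<close>
    have "\<bar>f2 x\<bar> \<le> 63 / 160 * v ^ 3"
      using le[of "4 / v"] v(1) unfolding v(2) by (simp add: field_simps power_numeral_reduce)
    \<comment> \<open>Equivalent to \<open>pi <= 640 / 189\<close>, which is about 3.386.\<close>
    also have "63 / 160 \<le> 4 / (3 * pi)"
      using pi_approx by (simp add: field_simps)
    then have "63 / 160 * v ^ 3 \<le> 4 / (3 * pi) * v ^ 3"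
      using v by (intro mult_right_mono) auto
    finally show ?thesis using v by simp
  qed
qed

section \<open>Bounding a density by the integral of its characteristic function\<close>

lemma real_distribution_density:
  assumes "prob_density K"
  shows "real_distribution (density lborel (\<lambda>x. ennreal (K x)))"
  using assms
  by (auto simp: prob_density_def real_distribution_def real_distribution_axioms_def emeasure_density
      intro!: prob_spaceI)

text \<open>Domination by \<open>A\<close> times Lebesgue measure passes from half-open intervals to
  Borel sets, and a set of positive measure on which \<open>K\<close> exceeds \<open>A + e\<close>
  would contradict it.\<close>

lemma density_le_const:
  fixes K :: "real \<Rightarrow> real"
  assumes dens: "prob_density K"
    and ioc: "\<And>a b. a \<le> b \<Longrightarrow> measure (density lborel (\<lambda>x. ennreal (K x))) {a<..b} \<le> A * (b - a)"
  shows "AE x in lborel. K x \<le> A"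
proof -
  have [measurable]: "K \<in> borel_measurable borel"
    using dens by (auto simp: prob_density_def)
  define D where "D = density lborel (\<lambda>x. ennreal (K x))"
  interpret D: real_distribution D
    unfolding D_def by (rule real_distribution_density[OF dens])
  have A0: "0 \<le> A" using order_trans[OF measure_nonneg ioc[of 0 1]] by simp
  \<comment> \<open>The nondecreasing function \<open>F\<close> generates a measure that complements \<open>D\<close> to \<open>A\<close> times Lebesgue
    measure; this extends the bound from intervals to all Borel sets.\<close>
  define F where "F x = A * x - cdf D x" for x
  have mono: "F x \<le> F y" if "x \<le> y" for x y
    using ioc[of x y] that D.cdf_diff_eq[of x y]
    by (cases "x = y") (auto simp: F_def D_def algebra_simps)
  have rc: "continuous (at_right a) F" for a
    unfolding F_def[abs_def] by (intro continuous_intros D.cdf_is_right_cont)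
  define N where "N = interval_measure F"
  define S where "S = measure_of (UNIV :: real set) (sets borel) (\<lambda>X. emeasure D X + emeasure N X)"
  have sS [simp]: "sets S = sets borel"
    using sets.sigma_sets_eq[of "borel :: real measure"] by (simp add: S_def)
  have eS: "emeasure S X = emeasure D X + emeasure N X" if "X \<in> sets borel" for X
  proof (rule emeasure_measure_of[OF S_def])
    show "countably_additive (sets S) (\<lambda>X. emeasure D X + emeasure N X)"
    proof (rule countably_additiveI)
      fix B :: "nat \<Rightarrow> real set"
      assume "range B \<subseteq> sets S" "disjoint_family B"
      then show "(\<Sum>i. emeasure D (B i) + emeasure N (B i)) = emeasure D (\<Union>i. B i) + emeasure N (\<Union>i. B i)"
        by (subst suminf_add[symmetric]) (auto simp: suminf_emeasure N_def D_def)
    qed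
  qed (use that in \<open>auto simp: positive_def\<close>)
  define U where "U = density lborel (\<lambda>x::real. ennreal A)"
  have eU: "emeasure U X = ennreal A * emeasure lborel X" if "X \<in> sets borel" for X
    using that by (simp add: U_def emeasure_density nn_integral_cmult_indicator)
  \<comment> \<open>On \<open>{a<..b}\<close> the increments of \<open>cdf D\<close> cancel and
    leave \<open>A * (b - a)\<close>; these intervals form a generating system closed under
    intersection.\<close>
  have "S = U"
  proof (rule measure_eqI_generator_eq[where \<Omega> = UNIV and E = "range (\<lambda>(a, b). {a<..b::real})"
        and A = "\<lambda>i. {- real i<..real i}"])
    fix X assume "X \<in> range (\<lambda>(a, b). {a<..b::real})"
    then obtain a b where X: "X = {a<..b}" by auto
    show "emeasure S X = emeasure U X"
    proof (cases "a < b")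
      case True
      then have "emeasure S X = ennreal (cdf D b - cdf D a) + ennreal (F b - F a)"
        unfolding N_def X
        by (simp add: eS N_def emeasure_interval_measure_Ioc mono rc D.emeasure_Ioc)
      also have "\<dots> = ennreal (A * (b - a))"
        using True mono[of a b] D.cdf_nondecreasing[of a b]
        by (subst ennreal_plus[symmetric]) (auto simp: F_def algebra_simps)
      finally show ?thesis
        using True A0 by (simp add: X eU ennreal_mult)
    qed (simp add: X)
  next
    show "(\<Union>i. {- real (i::nat)<..real i}) = UNIV"
      by (rule UN_Ioc_eq_UNIV)
    show "emeasure S {- real i<..real i} \<noteq> \<infinity>" for i
      by (simp add: eS N_def D.emeasure_Ioc emeasure_interval_measure_Ioc mono rc)
  qed (auto simp: borel_sigma_sets_Ioc Int_stable_def U_def)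
  then have le: "emeasure D X \<le> ennreal A * emeasure lborel X" if "X \<in> sets borel" for X
    using eS[OF that] eU[OF that] by (metis le_iff_add)
  show ?thesis
  proof (rule AE_upper_bound_inf)
    fix e :: real assume e: "e > 0"
    \<comment> \<open>Cutting to a bounded interval keeps the measure finite, so that comparing the
      factors \<open>A + e\<close> and \<open>A\<close> forces it to be 0.\<close>
    define X where "X m = {x. A + e < K x} \<inter> {- real m..real m}" for m :: nat
    have [measurable]: "X m \<in> sets borel" for m unfolding X_def by measurable
    have null: "X m \<in> null_sets lborel" for m
    proof -
      have "(A + e) * measure lborel (X m) \<le> A * measure lborel (X m)"
      proof -
        have fin: "emeasure lborel (X m) < \<infinity>"
          by (rule le_less_trans[OF emeasure_mono[of _ "{- real m..real m}"]]) (auto simp: X_def)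
        have "ennreal (A + e) * emeasure lborel (X m) = (\<integral>\<^sup>+x. ennreal (A + e) * indicator (X m) x \<partial>lborel)"
          by (simp add: nn_integral_cmult_indicator)
        also have "\<dots> \<le> (\<integral>\<^sup>+x. ennreal (K x) * indicator (X m) x \<partial>lborel)"
          by (intro nn_integral_mono) (auto simp: X_def indicator_def intro!: ennreal_leI)
        also have "\<dots> = emeasure D (X m)" by (simp add: D_def emeasure_density)
        also have "\<dots> \<le> ennreal A * emeasure lborel (X m)" by (rule le) simp
        finally show ?thesis
          using fin A0 e
          by (simp add: emeasure_eq_ennreal_measure ennreal_mult[symmetric] del: ennreal_plus)
      qed
      then have "measure lborel (X m) = 0"
        using e measure_nonneg[of lborel "X m"]
        by (simp add: distrib_right) (metis antisym mult_le_0_iff measure_nonneg not_less)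
      moreover have "emeasure lborel (X m) < \<infinity>"
        by (rule le_less_trans[OF emeasure_mono[of _ "{- real m..real m}"]]) (auto simp: X_def)
      ultimately show ?thesis
        by (intro null_setsI) (auto simp: emeasure_eq_ennreal_measure)
    qed
    have "AE x in lborel. \<forall>m. x \<notin> X m"
      using null by (simp add: AE_all_countable AE_not_in)
    then show "AE x in lborel. K x \<le> A + e"
    proof eventually_elim
      case (elim x)
      obtain m where "\<bar>x\<bar> \<le> real m" using real_arch_simple by blast
      with elim have "x \<notin> X m" "x \<in> {- real m..real m}" by auto
      then show ?case by (auto simp: X_def)
    qed
  qed
qed

text \<open>Levy inversion expresses the mass of an interval by the characteristic function times a
  factor of modulus at most \<open>b - a\<close>. The conclusion holds only almost everywhere
  because changing \<open>K\<close> on a null set leaves its characteristic function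
  unchanged.\<close>

lemma prob_density_le_A_const:
  assumes dens: "prob_density K"
    and int: "integrable lborel (\<lambda>t. cmod (char_density K t))"
  shows "AE x in lborel. K x \<le> A_const K"
proof (rule density_le_const[OF dens])
  fix a b :: real assume ab: "a \<le> b"
  have [measurable]: "K \<in> borel_measurable borel"
    using dens by (auto simp: prob_density_def)
  define D where "D = density lborel (\<lambda>x. ennreal (K x))"
  interpret D: real_distribution D
    unfolding D_def by (rule real_distribution_density[OF dens])
  \<comment> \<open>The inversion formula requires that the endpoints carry no mass.\<close>
  have atom: "measure D {c} = 0" for c
  proof -
    have "emeasure D {c} = 0"
      unfolding D_def by (simp add: emeasure_density nn_integral_null_set)
    then show ?thesis by (simp add: measure_def)
  qed
  define g where "g t = (iexp (-(t * a)) - iexp (-(t * b))) / (\<i> * t) * char D t" for t :: real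
  \<comment> \<open>At \<open>t = 0\<close> division by zero yields \<open>g 0 = 0\<close>, so the
    estimate holds there too.\<close>
  have gle: "cmod (g t) \<le> (b - a) * cmod (char_density K t)" for t
  proof (cases "t = 0")
    case False
    have "cmod ((iexp (-(t * a)) - iexp (-(t * b))) / (\<i> * t)) \<le> b - a"
      using Levy_Inversion_aux2[of "- b" "- a" t] ab False by simp
    then show ?thesis
      unfolding g_def norm_mult char_density_def D_def by (rule mult_right_mono) simp
  qed (use ab in \<open>simp add: g_def\<close>)
  have [measurable]: "char D \<in> borel_measurable borel" by (rule D.char_measurable)
  have gint: "integrable lborel g"
  proof (rule Bochner_Integration.integrable_bound)
    show "integrable lborel (\<lambda>t. (b - a) * cmod (char_density K t))" using int by simp
    show "g \<in> borel_measurable lborel" unfolding g_def[abs_def] by measurable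
  qed (use gle ab in \<open>auto simp: abs_mult\<close>)
  have "cmod (1 / (2 * pi) * (CLBINT t=-T..T. g t)) \<le> A_const K * (b - a)" for T :: nat
  proof -
    have "cmod (CLBINT t=-T..T. g t) = cmod (LINT t|lborel. indicator {- real T..real T} t *\<^sub>R g t)"
      by (simp add: interval_integral_Icc set_lebesgue_integral_def)
    also have "\<dots> \<le> (LINT t|lborel. (b - a) * cmod (char_density K t))"
      using int ab gle gint
      by (intro Bochner_Integration.integral_norm_bound_integral integrable_mult_indicator) (auto simp: indicator_def)
    also have "\<dots> = (b - a) * (LINT t|lborel. cmod (char_density K t))" by simp
    finally show ?thesis
      by (simp add: A_const_def norm_mult norm_divide field_simps)
  qed
  moreover have "(\<lambda>T::nat. cmod (1 / (2 * pi) * (CLBINT t=-T..T. g t))) \<longlonglongrightarrow> cmod (measure D {a<..b})"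
    using D.Levy_Inversion[OF ab atom atom] unfolding g_def by (rule tendsto_norm)
  ultimately have "cmod (measure D {a<..b}) \<le> A_const K * (b - a)"
    by (intro LIMSEQ_le_const2) auto
  then show "measure (density lborel (\<lambda>x. ennreal (K x))) {a<..b} \<le> A_const K * (b - a)"
    by (simp add: D_def)
qed

section \<open>Mean squared error of an average of independent variables\<close>

text \<open>Each new summand is independent of the sum of the others and centered, so the cross term
  vanishes. Integrability is part of the induction because splitting the expectation relies on
  it.\<close>

lemma (in prob_space) second_moment_sum_indep_centered:
  fixes Y :: "'i \<Rightarrow> 'a \<Rightarrow> real"
  assumes "finite I" "indep_vars (\<lambda>_. borel) Y I"
    and "\<And>i. i \<in> I \<Longrightarrow> integrable M (\<lambda>\<omega>. (Y i \<omega>)\<^sup>2)"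
    and "\<And>i. i \<in> I \<Longrightarrow> expectation (Y i) = 0"
  shows "integrable M (\<lambda>\<omega>. (\<Sum>i\<in>I. Y i \<omega>)\<^sup>2) \<and>
    expectation (\<lambda>\<omega>. (\<Sum>i\<in>I. Y i \<omega>)\<^sup>2) = (\<Sum>i\<in>I. expectation (\<lambda>\<omega>. (Y i \<omega>)\<^sup>2))"
  using assms
proof (induction I)
  case (insert i I)
  have rv: "random_variable borel (Y j)" if "j \<in> insert i I" for j
    using insert.prems(1) that by (auto simp: indep_vars_def)
  have int: "integrable M (Y j)" if "j \<in> insert i I" for j
    using square_integrable_imp_integrable[OF rv[OF that] insert.prems(2)[OF that]] .
  define S where "S \<omega> = (\<Sum>j\<in>I. Y j \<omega>)" for \<omega>
  have IH: "integrable M (\<lambda>\<omega>. (S \<omega>)\<^sup>2)"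
    "expectation (\<lambda>\<omega>. (S \<omega>)\<^sup>2) = (\<Sum>j\<in>I. expectation (\<lambda>\<omega>. (Y j \<omega>)\<^sup>2))"
    unfolding S_def using insert.IH[OF indep_vars_subset[OF insert.prems(1)]] insert.prems by auto
  have S: "integrable M S" unfolding S_def[abs_def] using int by auto
  have indep: "indep_var borel (Y i) borel S"
    unfolding S_def[abs_def] by (rule indep_vars_sum[OF insert.hyps insert.prems(1)])
  have prod: "integrable M (\<lambda>\<omega>. Y i \<omega> * S \<omega>)" "expectation (\<lambda>\<omega>. Y i \<omega> * S \<omega>) = 0"
    using indep_var_integrable[OF indep int S] indep_var_lebesgue_integral[OF indep int S] insert.prems(3)
    by auto
  have sq: "(\<Sum>j\<in>insert i I. Y j \<omega>)\<^sup>2 = (Y i \<omega>)\<^sup>2 + 2 * (Y i \<omega> * S \<omega>) + (S \<omega>)\<^sup>2" for \<omega>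
    using insert.hyps by (simp add: S_def power2_sum algebra_simps)
  show ?case
    unfolding sq using prod IH insert.prems(2) insert.hyps by simp
qed simp

text \<open>Bias-variance decomposition about the common mean \<open>m\<close>: the cross term has
  mean zero, and the variance of each summand is bounded by its raw second moment.\<close>

lemma (in prob_space) MSE_mean_le:
  fixes Z :: "nat \<Rightarrow> 'a \<Rightarrow> real"
  assumes n: "n \<ge> 1" and indep: "indep_vars (\<lambda>_. borel) Z {1..n}"
    and int2: "\<And>j. j \<in> {1..n} \<Longrightarrow> integrable M (\<lambda>\<omega>. (Z j \<omega>)\<^sup>2)"
    and mean: "\<And>j. j \<in> {1..n} \<Longrightarrow> expectation (Z j) = m"
    and second: "\<And>j. j \<in> {1..n} \<Longrightarrow> expectation (\<lambda>\<omega>. (Z j \<omega>)\<^sup>2) \<le> v"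
  shows "MSE M (\<lambda>\<omega>. 1 / real n * (\<Sum>j=1..n. Z j \<omega>)) \<theta> \<le> ennreal ((m - \<theta>)\<^sup>2 + v / real n)"
proof -
  have rv [measurable]: "random_variable borel (Z j)" if "j \<in> {1..n}" for j
    using indep that by (auto simp: indep_vars_def)
  have int: "integrable M (Z j)" if "j \<in> {1..n}" for j
    using square_integrable_imp_integrable[OF rv[OF that] int2[OF that]] .
  define Y where "Y j \<omega> = Z j \<omega> - m" for j \<omega>
  have Yi: "indep_vars (\<lambda>_. borel) Y {1..n}"
    unfolding Y_def[abs_def] by (rule indep_vars_compose2[OF indep, where Y = "\<lambda>_ z. z - m"]) simp
  have Ysq: "(Y j \<omega>)\<^sup>2 = (Z j \<omega>)\<^sup>2 - 2 * m * Z j \<omega> + m\<^sup>2" for j \<omega>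
    by (simp add: Y_def power2_diff)
  have Y2: "integrable M (\<lambda>\<omega>. (Y j \<omega>)\<^sup>2)" if "j \<in> {1..n}" for j
    unfolding Ysq using int[OF that] int2[OF that] by simp
  have Y0: "expectation (Y j) = 0" if "j \<in> {1..n}" for j
    unfolding Y_def[abs_def] using int[OF that] mean[OF that] by (simp add: prob_space)
  have Yv: "expectation (\<lambda>\<omega>. (Y j \<omega>)\<^sup>2) \<le> v" if "j \<in> {1..n}" for j
  proof -
    have "expectation (\<lambda>\<omega>. (Y j \<omega>)\<^sup>2) = expectation (\<lambda>\<omega>. (Z j \<omega>)\<^sup>2) - m\<^sup>2"
      unfolding Ysq using int[OF that] int2[OF that] mean[OF that] by (simp add: prob_space power2_eq_square)
    then show ?thesis using second[OF that] zero_le_power2[of m] by linarith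
  qed
  define S where "S \<omega> = (\<Sum>j=1..n. Y j \<omega>)" for \<omega>
  have S2: "integrable M (\<lambda>\<omega>. (S \<omega>)\<^sup>2)"
    "expectation (\<lambda>\<omega>. (S \<omega>)\<^sup>2) = (\<Sum>j=1..n. expectation (\<lambda>\<omega>. (Y j \<omega>)\<^sup>2))"
    unfolding S_def using second_moment_sum_indep_centered[OF _ Yi Y2 Y0] by auto
  have Yint: "integrable M (Y j)" if "j \<in> {1..n}" for j
    unfolding Y_def[abs_def] using int[OF that] by simp
  have S1: "integrable M S" "expectation S = 0"
    unfolding S_def[abs_def] using Yint Y0 by auto
  have dec: "(1 / real n * (\<Sum>j=1..n. Z j \<omega>) - \<theta>)\<^sup>2
    = (S \<omega>)\<^sup>2 / (real n)\<^sup>2 + 2 * (m - \<theta>) / real n * S \<omega> + (m - \<theta>)\<^sup>2" for \<omega>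
  proof -
    have *: "1 / real n * (\<Sum>j=1..n. Z j \<omega>) - \<theta> = S \<omega> / real n + (m - \<theta>)"
      using n by (simp add: S_def Y_def sum_subtractf field_simps)
    show ?thesis unfolding * power2_sum power_divide by simp
  qed
  have "MSE M (\<lambda>\<omega>. 1 / real n * (\<Sum>j=1..n. Z j \<omega>)) \<theta>
    = ennreal (expectation (\<lambda>\<omega>. (1 / real n * (\<Sum>j=1..n. Z j \<omega>) - \<theta>)\<^sup>2))"
    unfolding MSE_def
  proof (rule nn_integral_eq_integral)
    show "integrable M (\<lambda>\<omega>. (1 / real n * (\<Sum>j=1..n. Z j \<omega>) - \<theta>)\<^sup>2)"
      unfolding dec using S1 S2(1) by simp
  qed simp
  also have "expectation (\<lambda>\<omega>. (1 / real n * (\<Sum>j=1..n. Z j \<omega>) - \<theta>)\<^sup>2)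
    = (\<Sum>j=1..n. expectation (\<lambda>\<omega>. (Y j \<omega>)\<^sup>2)) / (real n)\<^sup>2 + (m - \<theta>)\<^sup>2"
    unfolding dec using S1 S2 by (simp add: prob_space)
  also have "\<dots> \<le> (real n * v) / (real n)\<^sup>2 + (m - \<theta>)\<^sup>2"
    using sum_mono[of "{1..n}" "\<lambda>j. expectation (\<lambda>\<omega>. (Y j \<omega>)\<^sup>2)" "\<lambda>_. v"] Yv
    by (intro add_right_mono divide_right_mono) auto
  also have "\<dots> = (m - \<theta>)\<^sup>2 + v / real n"
    using n by (simp add: power2_eq_square)
  finally show ?thesis by (simp add: ennreal_leI)
qed

section \<open>Moments and bias of the rescaled kernel\<close>

text \<open>Substitution \<open>y = x - h * u\<close>, with Jacobian \<open>h\<close>. The general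
  \<open>Q\<close> covers both the first and the second moment of the scaled kernel.\<close>

lemma distributed_rescaled:
  fixes Q p :: "real \<Rightarrow> real"
  assumes X: "distributed M lborel X (\<lambda>x. ennreal (p x))" and p: "prob_density p"
    and [measurable]: "Q \<in> borel_measurable borel" and h: "h > 0"
  shows "integrable M (\<lambda>\<omega>. Q ((x - X \<omega>) / h)) \<longleftrightarrow> integrable lborel (\<lambda>u. Q u * p (x - h * u))"
    and "(LINT \<omega>|M. Q ((x - X \<omega>) / h)) = h * (LINT u|lborel. Q u * p (x - h * u))"
proof -
  have p0: "0 \<le> p y" for y using p by (simp add: prob_density_def)
  \<comment> \<open>The form \<open>x + - h * u\<close> matches the affine substitution rule with
    factor \<open>- h\<close>.\<close>
  have eq: "p (x + - h * u) * Q ((x - (x + - h * u)) / h) = Q u * p (x - h * u)" for u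
    using h by (simp add: mult.commute)
  show "integrable M (\<lambda>\<omega>. Q ((x - X \<omega>) / h)) \<longleftrightarrow> integrable lborel (\<lambda>u. Q u * p (x - h * u))"
    using distributed_integrable[OF X, of "\<lambda>y. Q ((x - y) / h)"] p0 h
      lborel_integrable_real_affine_iff[of "- h" "\<lambda>y. p y * Q ((x - y) / h)" x, unfolded eq]
    by simp
  show "(LINT \<omega>|M. Q ((x - X \<omega>) / h)) = h * (LINT u|lborel. Q u * p (x - h * u))"
    using distributed_integral[OF X, of "\<lambda>y. Q ((x - y) / h)"] p0 h
      lborel_integral_real_affine[of "- h" "\<lambda>y. p y * Q ((x - y) / h)" x, unfolded eq]
    by simp
qed

text \<open>Second-order Taylor expansion at \<open>x\<close>: the linear term vanishes because
  \<open>K\<close> has mean zero, and the remainder integrates to a multiple of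
  \<open>mu2 K\<close>.\<close>

lemma kernel_smoothing_bias:
  fixes f f1 f2 K :: "real \<Rightarrow> real"
  assumes deriv: "\<And>x. (f has_real_derivative f1 x) (at x)"
    "\<And>x. (f1 has_real_derivative f2 x) (at x)"
    and bound: "\<And>x. \<bar>f2 x\<bar> \<le> C"
    and K: "prob_density K" "integrable lborel (\<lambda>x. x\<^sup>2 * K x)" "(LINT x|lborel. x * K x) = 0"
    and int: "integrable lborel (\<lambda>u. K u * f (x - h * u))"
  shows "\<bar>(LINT u|lborel. K u * f (x - h * u)) - f x\<bar> \<le> h\<^sup>2 / 2 * C * mu2 K"
proof -
  have K0: "\<And>x. 0 \<le> K x" and [measurable]: "K \<in> borel_measurable borel"
    and K1: "(\<integral>\<^sup>+x. ennreal (K x) \<partial>lborel) = 1"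
    using K(1) by (auto simp: prob_density_def)
  have iK: "integrable lborel K" and int1: "(LINT x|lborel. K x) = 1"
    using K0 K1 by (auto simp: integrable_iff_bounded integral_eq_nn_integral)
  \<comment> \<open>The vanishing first moment alone does not give integrability, since 0 is also
    the default value of the Bochner integral; domination by \<open>K x + x\<^sup>2 * K x\<close>
    does.\<close>
  have ixK: "integrable lborel (\<lambda>x. x * K x)"
  proof (rule Bochner_Integration.integrable_bound)
    show "integrable lborel (\<lambda>x. K x + x\<^sup>2 * K x)" using iK K(2) by simp
    show "AE x in lborel. norm (x * K x) \<le> norm (K x + x\<^sup>2 * K x)"
    proof (rule AE_I2)
      fix x :: real
      have "2 * \<bar>x\<bar> \<le> 1 + x\<^sup>2" using zero_le_power2[of "\<bar>x\<bar> - 1"] by (simp add: power2_diff)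
      then have "\<bar>x\<bar> * K x \<le> (1 + x\<^sup>2) * K x" using K0 by (intro mult_right_mono) auto
      then show "norm (x * K x) \<le> norm (K x + x\<^sup>2 * K x)"
        using K0[of x] by (simp add: abs_mult algebra_simps)
    qed
  qed simp
  have taylor: "\<bar>f (x - h * u) - f x + h * u * f1 x\<bar> \<le> C * (h * u)\<^sup>2 / 2" for u
  proof -
    \<comment> \<open>The derivatives indexed by order and shifted so that \<open>x\<close> becomes
      the origin, as the two-sided Maclaurin theorem expects.\<close>
    define d where "d m = (if m = (0::nat) then (\<lambda>t. f (x + t)) else if m = 1 then (\<lambda>t. f1 (x + t)) else (\<lambda>t. f2 (x + t)))" for m
    have d01: "(d 0 has_real_derivative d (Suc 0) t) (at t)" "(d (Suc 0) has_real_derivative d (Suc (Suc 0)) t) (at t)" for t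
      using DERIV_shift[of f "f1 (x + t)" t x] DERIV_shift[of f1 "f2 (x + t)" t x] deriv
      by (simp_all add: d_def add.commute)
    have "\<forall>m t. m < 2 \<and> \<bar>t\<bar> \<le> \<bar>- (h * u)\<bar> \<longrightarrow> (d m has_real_derivative d (Suc m) t) (at t)"
      using d01 by (auto simp: less_2_cases_iff)
    then obtain t where "f (x - h * u) = (\<Sum>m<2. d m 0 / fact m * (- (h * u)) ^ m) + d 2 t / fact 2 * (- (h * u))\<^sup>2"
      using Maclaurin_bi_le[of d "\<lambda>t. f (x + t)" 2 "- (h * u)"] by (auto simp: d_def)
    then have eq: "f (x - h * u) - f x + h * u * f1 x = f2 (x + t) * (h * u)\<^sup>2 / 2"
      by (simp add: d_def numeral_2_eq_2)
    show ?thesis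
      unfolding eq using bound[of "x + t"] by (simp add: abs_mult mult_right_mono)
  qed
  \<comment> \<open>Unit mass and zero mean of \<open>K\<close> bring the first-order Taylor
    polynomial under the integral.\<close>
  have eq: "(LINT u|lborel. K u * f (x - h * u)) - f x
    = (LINT u|lborel. K u * f (x - h * u) - f x * K u + h * f1 x * (u * K u))"
    using int iK ixK K(3) int1 by simp
  have "norm (LINT u|lborel. K u * f (x - h * u) - f x * K u + h * f1 x * (u * K u))
    \<le> (LINT u|lborel. h\<^sup>2 / 2 * C * (u\<^sup>2 * K u))"
  proof (rule Bochner_Integration.integral_norm_bound_integral)
    fix u :: real
    have "K u * f (x - h * u) - f x * K u + h * f1 x * (u * K u) = K u * (f (x - h * u) - f x + h * u * f1 x)"
      by (simp add: algebra_simps)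
    then have "\<bar>K u * f (x - h * u) - f x * K u + h * f1 x * (u * K u)\<bar>
      = K u * \<bar>f (x - h * u) - f x + h * u * f1 x\<bar>"
      using K0[of u] by (simp add: abs_mult)
    also have "\<dots> \<le> K u * (C * (h * u)\<^sup>2 / 2)"
      by (intro mult_left_mono taylor K0)
    finally show "norm (K u * f (x - h * u) - f x * K u + h * f1 x * (u * K u)) \<le> h\<^sup>2 / 2 * C * (u\<^sup>2 * K u)"
      by (simp add: power_mult_distrib algebra_simps)
  qed (use int iK ixK K(2) in auto)
  then show ?thesis unfolding eq by (simp add: mu2_def)
qed

section \<open>Combining bias and variance at the chosen bandwidth\<close>

theorem theorem3:
  fixes M :: "'a measure" and X :: "nat \<Rightarrow> 'a \<Rightarrow> real" and n :: nat
    and p K :: "real \<Rightarrow> real" and a h0 V3 :: real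
  assumes "prob_space M" and "n \<ge> 1"
    and "prob_density p"
    and "prob_space.indep_vars M (\<lambda>_. borel) X {1..n}"
    and "\<And>j. j \<in> {1..n} \<Longrightarrow> distributed M lborel (X j) (\<lambda>x. ennreal (p x))"
    and "prob_density K"
    and "integrable lborel (\<lambda>x. (K x)\<^sup>2)"
    and "integrable lborel (\<lambda>x. x\<^sup>2 * K x)"
    and "(LINT x|lborel. x * K x) = 0"
    and "integrable lborel (\<lambda>t. cmod (char_density K t))"
    and "\<And>k x. k < 3 \<Longrightarrow> (deriv ^^ k) p differentiable (at x)"
    and "0 \<le> V3" and "total_variation ((deriv ^^ 3) p) = ennreal V3"
    and "\<And>x. p x \<le> a"
    and "h0 > 0"
  shows "(SUP x. MSE M (kernel_estimator K (h0 * real n powr (- 1 / 5)) n X x) (p x))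
    \<le> ennreal ((4 / (9 * pi\<^sup>2) * (mu2 K)\<^sup>2 * V3 powr (3 / 2) * h0 ^ 4 + 2 * a * A_const K / h0)
         * real n powr (- 4 / 5))"
proof (rule SUP_least)
  fix x :: real
  interpret prob_space M by fact
  have p0: "0 \<le> p y" for y using assms(3) by (simp add: prob_density_def)
  have K0: "0 \<le> K y" for y using assms(6) by (simp add: prob_density_def)
  have [measurable]: "p \<in> borel_measurable borel" "K \<in> borel_measurable borel"
    using assms(3,6) by (auto simp: prob_density_def)
  have iK: "integrable lborel K" and int1: "(LINT x|lborel. K x) = 1"
    using K0 assms(6) by (auto simp: prob_density_def integrable_iff_bounded integral_eq_nn_integral)
  have "((deriv ^^ k) p has_real_derivative (deriv ^^ Suc k) p y) (at y)" if "k < 3" for k y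
    using assms(11)[OF that] by (simp add: DERIV_deriv_iff_real_differentiable)
  from this[of 0] this[of 1] this[of 2]
  have d: "(p has_real_derivative deriv p y) (at y)"
    "(deriv p has_real_derivative (deriv ^^ 2) p y) (at y)"
    "((deriv ^^ 2) p has_real_derivative (deriv ^^ 3) p y) (at y)" for y
    by (simp_all add: numeral_2_eq_2 numeral_3_eq_3)
  define C where "C = 4 / (3 * pi) * V3 powr (3 / 4)"
  have C: "\<bar>(deriv ^^ 2) p y\<bar> \<le> C" for y
    unfolding C_def by (rule second_derivative_bound[OF d assms(3,14,13,12)])
  \<comment> \<open>With \<open>h = h0 * r\<close> and \<open>1 / n = r ^ 5\<close>, both
    \<open>h ^ 4\<close> and \<open>1 / (n * h)\<close> are constant multiples of
    \<open>r ^ 4\<close>.\<close>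
  define r where "r = real n powr (- 1 / 5)"
  have r: "r > 0" "real n powr (- 4 / 5) = r ^ 4" "1 / real n = r ^ 5"
  proof -
    show r0: "r > 0" using assms(2) by (simp add: r_def)
    have rk: "r ^ k = real n powr (- 1 / 5 * real k)" for k
      using powr_realpow[OF r0, of k] unfolding r_def powr_powr by simp
    show "real n powr (- 4 / 5) = r ^ 4" "1 / real n = r ^ 5"
      using assms(2) by (simp_all add: rk powr_minus_divide)
  qed
  define h where "h = h0 * r"
  have h: "h > 0" using assms(15) r by (simp add: h_def)
  define Z where "Z j \<omega> = scaled_kernel K h (x - X j \<omega>)" for j \<omega>
  define m where "m = (LINT u|lborel. K u * p (x - h * u))"
  have Km: "(\<lambda>u. K u / h) \<in> borel_measurable borel" "(\<lambda>u. (K u / h)\<^sup>2) \<in> borel_measurable borel"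
    by measurable
  have i1: "integrable lborel (\<lambda>u. K u * p (x - h * u))"
    by (rule Bochner_Integration.integrable_bound[of _ "\<lambda>u. K u * a"])
      (use iK K0 p0 assms(14) in \<open>auto intro!: mult_left_mono order_trans[OF _ abs_ge_self] simp: abs_mult\<close>)
  have i2: "integrable lborel (\<lambda>u. (K u)\<^sup>2 * p (x - h * u))"
    by (rule Bochner_Integration.integrable_bound[of _ "\<lambda>u. (K u)\<^sup>2 * a"])
      (use assms(7) K0 p0 assms(14) in \<open>auto intro!: mult_left_mono order_trans[OF _ abs_ge_self] simp: abs_mult\<close>)
  have A: "AE u in lborel. K u \<le> A_const K"
    by (rule prob_density_le_A_const[OF assms(6,10)])
  \<comment> \<open>One factor \<open>K u\<close> is replaced by \<open>A_const K\<close> and the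
    density by \<open>a\<close>; the other factor \<open>K u\<close> integrates to 1.\<close>
  have le2: "(LINT u|lborel. (K u)\<^sup>2 * p (x - h * u)) \<le> a * A_const K"
  proof -
    have "(LINT u|lborel. (K u)\<^sup>2 * p (x - h * u)) \<le> (LINT u|lborel. A_const K * a * K u)"
    proof (rule integral_mono_AE)
      show "AE u in lborel. (K u)\<^sup>2 * p (x - h * u) \<le> A_const K * a * K u"
        using A
      proof eventually_elim
        case (elim u)
        then have "K u * p (x - h * u) \<le> A_const K * a"
          using K0[of u] p0 assms(14) by (intro mult_mono) (auto intro: order_trans)
        then show ?case using mult_right_mono[OF _ K0[of u]] by (fastforce simp: power2_eq_square mult_ac)
      qed
    qed (use i2 iK in auto)
    then show ?thesis using int1 by (simp add: mult.commute)
  qed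
  have est: "kernel_estimator K (h0 * real n powr (- 1 / 5)) n X x = (\<lambda>\<omega>. 1 / real n * (\<Sum>j=1..n. Z j \<omega>))"
    by (simp add: fun_eq_iff kernel_estimator_def Z_def h_def r_def)
  have MSE: "MSE M (kernel_estimator K (h0 * real n powr (- 1 / 5)) n X x) (p x)
    \<le> ennreal ((m - p x)\<^sup>2 + a * A_const K / h / real n)"
    unfolding est
  proof (rule MSE_mean_le[OF assms(2)])
    show "indep_vars (\<lambda>_. borel) Z {1..n}"
      unfolding Z_def[abs_def]
      by (rule indep_vars_compose2[OF assms(4), where Y = "\<lambda>_ y. scaled_kernel K h (x - y)"])
        (simp add: scaled_kernel_def)
    fix j assume j: "j \<in> {1..n}"
    note aff = distributed_rescaled[OF assms(5)[OF j] assms(3) _ h, where x = x]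
    have Z1: "Z j = (\<lambda>\<omega>. K ((x - X j \<omega>) / h) / h)"
      by (simp add: Z_def[abs_def] scaled_kernel_def)
    have Z2: "(\<lambda>\<omega>. (Z j \<omega>)\<^sup>2) = (\<lambda>\<omega>. (K ((x - X j \<omega>) / h) / h)\<^sup>2)"
      by (simp add: Z1)
    have eq2: "(\<lambda>u. (K u / h)\<^sup>2 * p (x - h * u)) = (\<lambda>u. (K u)\<^sup>2 * p (x - h * u) / h\<^sup>2)"
      by (simp add: power_divide)
    show "integrable M (\<lambda>\<omega>. (Z j \<omega>)\<^sup>2)"
      unfolding Z2 aff(1)[OF Km(2)] eq2 using i2 by simp
    show "expectation (Z j) = m"
      unfolding Z1 aff(2)[OF Km(1)] m_def using h by simp
    \<comment> \<open>The squared scaling \<open>1 / h\<^sup>2\<close> and the Jacobian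
      \<open>h\<close> combine to \<open>1 / h\<close>.\<close>
    have "expectation (\<lambda>\<omega>. (Z j \<omega>)\<^sup>2) = (LINT u|lborel. (K u)\<^sup>2 * p (x - h * u)) / h"
      unfolding Z2 aff(2)[OF Km(2)] eq2 using h by (simp add: power2_eq_square)
    then show "expectation (\<lambda>\<omega>. (Z j \<omega>)\<^sup>2) \<le> a * A_const K / h"
      using le2 h by (simp add: divide_right_mono)
  qed
  have "(m - p x)\<^sup>2 \<le> (h\<^sup>2 / 2 * C * mu2 K)\<^sup>2"
    using power_mono[OF kernel_smoothing_bias[OF d(1,2) C assms(6,8,9) i1] abs_ge_zero, of 2]
    by (simp only: m_def power2_abs)
  \<comment> \<open>The constant is \<open>C\<^sup>2 / 4\<close> with
    \<open>C = 4 / (3 * pi) * V3 powr (3 / 4)\<close>.\<close>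
  also have "\<dots> = 4 / (9 * pi\<^sup>2) * (mu2 K)\<^sup>2 * V3 powr (3 / 2) * h0 ^ 4 * r ^ 4"
  proof -
    have "V3 powr (3 / 2) = (V3 powr (3 / 4))\<^sup>2"
      by (simp add: power2_eq_square powr_add[symmetric])
    then show ?thesis
      by (simp add: C_def h_def power_mult_distrib power_divide)
  qed
  finally have bias: "(m - p x)\<^sup>2 \<le> 4 / (9 * pi\<^sup>2) * (mu2 K)\<^sup>2 * V3 powr (3 / 2) * h0 ^ 4 * r ^ 4" .
  \<comment> \<open>The variance term arises with factor 1; nonnegativity allows enlarging it to the
    stated factor 2.\<close>
  have aA: "0 \<le> a * A_const K"
    using le2 by (rule order_trans[rotated]) (simp add: p0)
  have "a * A_const K / h / real n = a * A_const K / h0 * r ^ 4"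
  proof -
    have "a * A_const K / h / real n = a * A_const K / h * r ^ 5" unfolding r(3)[symmetric] by simp
    also have "\<dots> = a * A_const K / h0 * r ^ 4"
      using r(1) assms(15) by (simp add: h_def field_simps power_numeral_reduce)
    finally show ?thesis .
  qed
  also have "\<dots> \<le> 2 * a * A_const K / h0 * r ^ 4"
  proof -
    have "a * A_const K \<le> 2 * a * A_const K" using aA by linarith
    then show ?thesis
      by (rule mult_right_mono[OF divide_right_mono]) (use assms(15) r(1) in auto)
  qed
  finally have "(m - p x)\<^sup>2 + a * A_const K / h / real n
    \<le> (4 / (9 * pi\<^sup>2) * (mu2 K)\<^sup>2 * V3 powr (3 / 2) * h0 ^ 4 + 2 * a * A_const K / h0) * real n powr (- 4 / 5)"
    using bias unfolding r(2) by (simp add: distrib_right)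
  with MSE show "MSE M (kernel_estimator K (h0 * real n powr (- 1 / 5)) n X x) (p x)
    \<le> ennreal ((4 / (9 * pi\<^sup>2) * (mu2 K)\<^sup>2 * V3 powr (3 / 2) * h0 ^ 4 + 2 * a * A_const K / h0)
         * real n powr (- 4 / 5))"
    by (rule order_trans[OF _ ennreal_leI])
qed

end
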